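(* For every integer $r\ge 1$, the $(1,1)$ (upper-left) entry of the inverse of the matrix $V_{r-1}$ is $$(V_{r-1}^{-1})_{1,1}=2\left(\frac{\binom{4r}{2r}}{\binom{2r}{r}^{2}}-1\right).$$
   Context: For the fixed integer $r\ge 1$, put $I_k:=\sum_{c=1}^{r}c^k$ (so $I_0=r$), and for $n\ge 0$ let $V_n:=(I_{2i+2j})_{0\le i,j\le n}$, an $(n+1)\times(n+1)$ matrix. In particular $V_{r-1}$ is $r\times r$, with upper-left entry $I_0$; it is invertible. *)

theory Defs
  imports Complex_Main "Jordan_Normal_Form.Matrix"
begin

definition power_sum :: "nat \<Rightarrow> nat \<Rightarrow> real"
  where "power_sum r k = (\<Sum>c = 1..r. real c ^ k)"

text \<open>The matrix $V_n$ of the fixed parameter \<open>r\<close>; it has size \<open>n + 1\<close>.\<close>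

definition V_mat :: "nat \<Rightarrow> nat \<Rightarrow> real mat"
  where "V_mat r n = mat (n + 1) (n + 1) (\<lambda>(i, j). power_sum r (2 * i + 2 * j))"

end

theory Submission
  imports Defs "Jordan_Normal_Form.Determinant"
begin

text \<open>
  With the Vandermonde matrix \<open>B\<close> of the nodes \<open>c\<^sup>2\<close>, \<open>1 \<le> c \<le> r\<close>, the matrix in question is
  \<open>B\<^sup>T B\<close>. The columns of \<open>B\<^sup>-\<^sup>1\<close> hold the coefficients of the Lagrange basis polynomials
  \<open>L\<^sub>c\<close>, so the upper-left entry of the inverse is the sum of the squares of the constant terms
  \<open>L\<^sub>c(0) = \<plusminus>2 (2r choose (r - c)) / (2r choose r)\<close>, and the sum of the squared binomial
  coefficients is half of \<open>4r choose 2r\<close> without its central term.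
\<close>

text \<open>The inverse of a Gram matrix is \<open>C * transpose_mat C\<close>, since a one-sided
  inverse of a square matrix is two-sided. The second claim speaks of an arbitrary inverse
  \<open>W\<close>, so it includes uniqueness.\<close>

lemma inverse_entry_gram:
  fixes B C W :: "'a :: field mat"
  assumes B: "B \<in> carrier_mat n n" and C: "C \<in> carrier_mat n n" and BC: "B * C = 1\<^sub>m n"
  shows "invertible_mat (transpose_mat B * B)"
    and "\<lbrakk>inverts_mat (transpose_mat B * B) W; inverts_mat W (transpose_mat B * B); i < n; j < n\<rbrakk>
      \<Longrightarrow> W $$ (i, j) = (\<Sum>k<n. C $$ (i, k) * C $$ (j, k))"
proof -
  let ?V = "transpose_mat B * B" and ?U = "C * transpose_mat C"
  have BT: "transpose_mat B \<in> carrier_mat n n" and CT: "transpose_mat C \<in> carrier_mat n n"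
    using B C by auto
  have V: "?V \<in> carrier_mat n n" and U: "?U \<in> carrier_mat n n"
    using BT B C CT by auto
  have CB: "C * B = 1\<^sub>m n"
    using mat_mult_left_right_inverse[OF B C BC] .
  have "?V * ?U = transpose_mat B * (B * (C * transpose_mat C))"
    using BT B U by (intro assoc_mult_mat)
  also have "B * (C * transpose_mat C) = transpose_mat C"
    using assoc_mult_mat[OF B C CT] BC CT by simp
  also have "transpose_mat B * transpose_mat C = 1\<^sub>m n"
    using transpose_mult[OF C B] CB by simp
  finally have VU: "?V * ?U = 1\<^sub>m n" .
  have UV: "?U * ?V = 1\<^sub>m n"
    using mat_mult_left_right_inverse[OF V U VU] .
  show "invertible_mat ?V"
    unfolding invertible_mat_def inverts_mat_def square_mat.simps
    using VU UV V U by (intro conjI exI[of _ ?U]) auto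
  assume W: "inverts_mat ?V W" "inverts_mat W ?V" and i: "i < n" and j: "j < n"
  \<comment> \<open>The size of \<open>W\<close> is read off by comparing column counts in the two
    inverse equations.\<close>
  have "dim_col W = n"
    using arg_cong[OF W(1)[unfolded inverts_mat_def], of dim_col] B by simp
  moreover have "dim_row W = n"
    using arg_cong[OF W(2)[unfolded inverts_mat_def], of dim_col] B by simp
  ultimately have Wc: "W \<in> carrier_mat n n" by auto
  have "W = W * (?V * ?U)" using VU Wc by simp
  also have "\<dots> = W * ?V * ?U" using assoc_mult_mat[OF Wc V U] by simp
  also have "W * ?V = 1\<^sub>m n" using W(2) Wc by (simp add: inverts_mat_def)
  also have "1\<^sub>m n * ?U = ?U" by (rule left_mult_one_mat[OF U])
  finally show "W $$ (i, j) = (\<Sum>k<n. C $$ (i, k) * C $$ (j, k))"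
    using C i j by (simp add: scalar_prod_def atLeast0LessThan)
qed

text \<open>The normalising constant is spread over the linear factors, so that values can be
  computed factor by factor.\<close>

definition lagrange_poly :: "('b \<Rightarrow> 'a :: field) \<Rightarrow> 'b set \<Rightarrow> 'b \<Rightarrow> 'a poly"
  where "lagrange_poly x S c = (\<Prod>d\<in>S - {c}. smult (1 / (x c - x d)) [:- x d, 1:])"

lemma poly_lagrange:
  assumes "finite S" "inj_on x S" "c \<in> S" "d \<in> S"
  shows "poly (lagrange_poly x S c) (x d) = (if c = d then 1 else 0)"
proof (cases "c = d")
  case True
  have "poly (lagrange_poly x S c) (x d) = (\<Prod>e\<in>S - {c}. 1)"
    unfolding lagrange_poly_def poly_prod
  proof (rule prod.cong)
    fix e assume "e \<in> S - {c}"
    hence "x c - x e \<noteq> 0" using assms by (auto dest: inj_onD)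
    thus "poly (smult (1 / (x c - x e)) [:- x e, 1:]) (x d) = 1"
      using True by (simp add: diff_divide_distrib[symmetric])
  qed simp
  thus ?thesis using True by simp
next
  case False
  thus ?thesis using assms by (auto simp: lagrange_poly_def poly_prod intro!: prod_zero)
qed

lemma degree_lagrange:
  assumes "finite S" "c \<in> S"
  shows "degree (lagrange_poly x S c) < card S"
proof -
  have "degree (lagrange_poly x S c) \<le> (\<Sum>d\<in>S - {c}. 1)"
    unfolding lagrange_poly_def
    by (rule order.trans[OF degree_prod_sum_le sum_mono]) (use assms in auto)
  also have "\<dots> = card (S - {c})" by (rule card_eq_sum[symmetric])
  also have "\<dots> < card S" by (rule card_Diff1_less[OF assms])
  finally show ?thesis .
qed

lemma prod_shift_fact:
  "(\<Prod>d=1..m. real d + real k) = fact (m + k) / fact k"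
proof (induction m)
  case (Suc m)
  have "(\<Prod>d=1..Suc m. real d + real k) = real (Suc m + k) * (\<Prod>d=1..m. real d + real k)"
    by simp
  thus ?case unfolding Suc by simp
qed simp

text \<open>Reversing the order of the factors turns them into -1, ..., -m.\<close>

lemma prod_diff_fact:
  "(\<Prod>d=1..m. real d - real (Suc m)) = (-1) ^ m * fact m"
proof -
  have "(\<Prod>d=1..m. real d - real (Suc m)) = (\<Prod>d=1..m. - real d)"
    by (subst prod.atLeastAtMost_rev, rule prod.cong) (auto simp: of_nat_diff)
  thus ?thesis by (simp add: prod_uminus fact_prod)
qed

text \<open>Induction on \<open>r\<close> starting at \<open>c\<close>. For \<open>r = c\<close> the
  factors split as (d - c)(d + c), giving (c-1)! (2c-1)! / c! up to sign, which is (2c)! / (2c^2).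
  Each step multiplies by (r+1-c)(r+1+c) and so advances both factorials by one.\<close>

lemma prod_diff_squares:
  assumes "1 \<le> c" "c \<le> r"
  shows "(\<Prod>d\<in>{1..r} - {c}. real d ^ 2 - real c ^ 2)
    = (-1) ^ (c - 1) * fact (r - c) * fact (r + c) / (2 * real c ^ 2)"
  using assms(2)
proof (induction r rule: dec_induct)
  case base
  obtain m where c: "c = Suc m" using assms by (cases c) auto
  have "{1..c} - {c} = {1..m}" using c by auto
  hence "(\<Prod>d\<in>{1..c} - {c}. real d ^ 2 - real c ^ 2)
      = (\<Prod>d=1..m. real d - real (Suc m)) * (\<Prod>d=1..m. real d + real (Suc m))"
    by (simp only: c prod.distrib[symmetric] power2_eq_square square_diff_square_factored)
      (simp add: mult.commute)
  also have "\<dots> = (-1) ^ m * fact m * (fact (m + Suc m) / fact (Suc m))"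
    by (simp only: prod_shift_fact prod_diff_fact)
  also have "\<dots> = (-1) ^ (c - 1) * fact (c - c) * fact (c + c) / (2 * real c ^ 2)"
    by (simp add: c field_simps power2_eq_square del: of_nat_Suc)
       (simp add: algebra_simps)
  finally show ?case .
next
  case (step r)
  have "{1..Suc r} - {c} = insert (Suc r) ({1..r} - {c})" using step by auto
  hence "(\<Prod>d\<in>{1..Suc r} - {c}. real d ^ 2 - real c ^ 2)
      = (real (Suc r) ^ 2 - real c ^ 2) * (\<Prod>d\<in>{1..r} - {c}. real d ^ 2 - real c ^ 2)"
    by simp
  also have "real (Suc r) ^ 2 - real c ^ 2 = real (Suc (r - c)) * real (Suc (r + c))"
    using step by (simp add: of_nat_diff power2_eq_square algebra_simps)
  finally show ?case
    using step by (simp add: Suc_diff_le del: of_nat_Suc)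
qed

lemma lagrange_squares_at_0:
  assumes "1 \<le> c" "c \<le> r"
  shows "(coeff (lagrange_poly (\<lambda>d. real d ^ 2) {1..r} c) 0) ^ 2
    = 4 * real ((2 * r) choose (r - c)) ^ 2 / real ((2 * r) choose r) ^ 2"
proof -
  have "coeff (lagrange_poly (\<lambda>d. real d ^ 2) {1..r} c) 0
      = (\<Prod>d\<in>{1..r} - {c}. real d ^ 2 / (real d ^ 2 - real c ^ 2))"
    unfolding lagrange_poly_def poly_0_coeff_0[symmetric] poly_prod
    by (intro prod.cong) (auto simp: minus_divide_right)
  also have "\<dots> = (\<Prod>d\<in>{1..r} - {c}. real d) ^ 2
      / (\<Prod>d\<in>{1..r} - {c}. real d ^ 2 - real c ^ 2)"
    by (simp add: prod_dividef prod_power_distrib)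
  also have "(\<Prod>d\<in>{1..r} - {c}. real d) = fact r / real c"
    using assms by (simp add: prod_diff1 fact_prod)
  finally have *: "coeff (lagrange_poly (\<lambda>d. real d ^ 2) {1..r} c) 0
      = (-1) ^ (c - 1) * (2 * fact r ^ 2 / (fact (r - c) * fact (r + c)))"
    unfolding prod_diff_squares[OF assms]
    using assms by (cases "even (c - 1)") (simp_all add: power_divide)
  \<comment> \<open>Extending the fraction by (2r)! turns the factorials into a quotient of binomial
    coefficients; squaring then removes the sign.\<close>
  have "real ((2 * r) choose (r - c)) = fact (2 * r) / (fact (r - c) * fact (r + c))"
    using assms by (subst binomial_fact) (auto simp: mult_2)
  moreover have "real ((2 * r) choose r) = fact (2 * r) / (fact r * fact r)"
    by (subst binomial_fact) (auto simp: mult_2)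
  ultimately have "2 * fact r ^ 2 / (fact (r - c) * fact (r + c))
      = 2 * real ((2 * r) choose (r - c)) / real ((2 * r) choose r)"
    by (simp add: power2_eq_square)
  thus ?thesis unfolding * by (simp add: power_mult_distrib power_divide flip: power_mult)
qed

text \<open>The squares of row 2r of Pascal's triangle sum to the central coefficient of row 4r, and
  the row is symmetric about its middle entry.\<close>

lemma sum_choose_squares_half:
  "2 * (\<Sum>c=1..r. ((2 * r) choose (r - c)) ^ 2) + ((2 * r) choose r) ^ 2 = (4 * r) choose (2 * r)"
proof -
  let ?f = "\<lambda>k. ((2 * r) choose k) ^ 2"
  have "{..2 * r} = ({..<r} \<union> {r<..2 * r}) \<union> {r}" by auto
  hence "(\<Sum>k\<le>2 * r. ?f k) = sum ?f ({..<r} \<union> {r<..2 * r}) + ?f r"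
    by simp
  also have "sum ?f ({..<r} \<union> {r<..2 * r}) = sum ?f {..<r} + sum ?f {r<..2 * r}"
    by (rule sum.union_disjoint) auto
  also have "sum ?f {..<r} = (\<Sum>c=1..r. ?f (r - c))"
    by (rule sum.reindex_bij_witness[of _ "\<lambda>c. r - c" "\<lambda>k. r - k"]) auto
  also have "sum ?f {r<..2 * r} = (\<Sum>c=1..r. ?f (r - c))"
  proof (rule sum.reindex_bij_witness[of _ "\<lambda>c. r + c" "\<lambda>k. k - r"])
    fix k assume "k \<in> {r<..2 * r}"
    thus "?f (r - (k - r)) = ?f k"
      using binomial_symmetric[of k "2 * r"] by (auto simp: mult_2)
  qed auto
  finally show ?thesis
    using choose_square_sum[of "2 * r"] by simp
qed

theorem proposition1p2:
  fixes r :: nat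
  assumes "r \<ge> 1"
  shows "invertible_mat (V_mat r (r - 1)) \<and>
    (\<forall>W. inverts_mat (V_mat r (r - 1)) W \<and> inverts_mat W (V_mat r (r - 1)) \<longrightarrow>
      W $$ (0, 0) = 2 * (real ((4 * r) choose (2 * r)) / real ((2 * r) choose r) ^ 2 - 1))"
proof -
  define L where "L = lagrange_poly (\<lambda>d. real d ^ 2) {1..r}"
  \<comment> \<open>Matrix indices start at 0, so row \<open>c\<close> belongs to the node (c+1)^2;
    \<open>shift\<close> translates the sums.\<close>
  define B where "B = mat r r (\<lambda>(c, i). real (Suc c) ^ (2 * i))"
  define C where "C = mat r r (\<lambda>(i, c). coeff (L (Suc c)) i)"
  have B: "B \<in> carrier_mat r r" and C: "C \<in> carrier_mat r r" by (auto simp: B_def C_def)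
  have shift: "(\<Sum>c<r. g (Suc c)) = (\<Sum>c=1..r. g c)" for g :: "nat \<Rightarrow> real"
    by (rule sum.reindex_bij_witness[of _ "\<lambda>c. c - 1" Suc]) auto
  have V: "V_mat r (r - 1) = transpose_mat B * B"
    using assms shift[of "\<lambda>c. real c ^ (2 * i + 2 * j)" for i j]
    by (intro eq_matI) (auto simp: V_mat_def B_def power_sum_def scalar_prod_def
        atLeast0LessThan simp flip: power_add simp del: of_nat_Suc)
  \<comment> \<open>As \<open>L c\<close> has degree below \<open>r\<close>, its first
    \<open>r\<close> coefficients determine its value at d^2. Rows of \<open>B\<close> thus evaluate
    the polynomials stored in the columns of \<open>C\<close>.\<close>
  have eval: "(\<Sum>i<r. real d ^ (2 * i) * coeff (L c) i) = (if c = d then 1 else 0)"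
    if "c \<in> {1..r}" "d \<in> {1..r}" for c d
  proof -
    have inj: "inj_on (\<lambda>d. real d ^ 2) {1..r}" by (auto intro!: inj_onI)
    have "degree (L c) < r"
      using degree_lagrange[of "{1..r}" c] that by (simp add: L_def)
    hence "(\<Sum>i<r. real d ^ (2 * i) * coeff (L c) i)
        = (\<Sum>i\<le>degree (L c). coeff (L c) i * (real d ^ 2) ^ i)"
      by (intro sum.mono_neutral_cong_right)
        (auto simp: coeff_eq_0 simp flip: power_mult)
    also have "\<dots> = poly (L c) (real d ^ 2)" by (simp add: poly_altdef)
    finally show ?thesis using poly_lagrange[OF _ inj that] by (simp add: L_def)
  qed
  have BC: "B * C = 1\<^sub>m r"
    using eval by (intro eq_matI)
      (auto simp: B_def C_def scalar_prod_def atLeast0LessThan simp del: of_nat_Suc)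
  have "W $$ (0, 0) = 2 * (real ((4 * r) choose (2 * r)) / real ((2 * r) choose r) ^ 2 - 1)"
    if "inverts_mat (V_mat r (r - 1)) W" "inverts_mat W (V_mat r (r - 1))" for W
  proof -
    have "W $$ (0, 0) = (\<Sum>c<r. (coeff (L (Suc c)) 0) ^ 2)"
      using inverse_entry_gram(2)[OF B C BC that[unfolded V], of 0 0] assms
      by (simp add: C_def power2_eq_square)
    also have "\<dots> = (\<Sum>c=1..r. (coeff (L c) 0) ^ 2)" by (rule shift)
    also have "\<dots> = (\<Sum>c=1..r. 4 * real ((2 * r) choose (r - c)) ^ 2 / real ((2 * r) choose r) ^ 2)"
      unfolding L_def by (intro sum.cong lagrange_squares_at_0) auto
    also have "\<dots> = 4 * (\<Sum>c=1..r. real ((2 * r) choose (r - c)) ^ 2) / real ((2 * r) choose r) ^ 2"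
      by (simp add: sum_distrib_left sum_divide_distrib)
    \<comment> \<open>Twice the sum of squares is (4r choose 2r) - (2r choose r)^2, which leaves a
      factor 2 of the 4.\<close>
    finally show ?thesis
      using arg_cong[OF sum_choose_squares_half[of r], of real]
      by (simp add: field_simps)
  qed
  thus ?thesis using inverse_entry_gram(1)[OF B C BC] V by simp
qed

end
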